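(* There exists $n_0 \in \mathbb{N}$ such that for every integer $n > n_0$ there exists a graph $G$ of order $n$ with $\delta_{loc}(G) > 0.189\, n$.
   Context: All graphs are finite, simple and undirected. The local complementation of a graph $G$ at a vertex $u$ is the graph $G * u = G \,\Delta\, K_{\mathcal{N}(u)}$, i.e. the edge set is replaced by its symmetric difference with the edge set of the complete graph on the neighborhood $\mathcal{N}(u)$ of $u$. Two graphs are locally equivalent, $G \equiv_{LC} G'$, if one can be obtained from the other by a finite sequence of local complementations. The local minimum degree is $\delta_{loc}(G) = \min\{\delta(G') : G' \equiv_{LC} G\}$, where $\delta(G')$ denotes the minimum degree of $G'$. *)

theory Defs
  imports Complex_Main
begin

record 'a graph =
  verts :: "'a set"
  edges :: "'a set set"

definition complete_edges :: "'a set \<Rightarrow> 'a set set" where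
  "complete_edges S = {e. e \<subseteq> S \<and> card e = 2}"

definition simple_graph :: "'a graph \<Rightarrow> bool" where
  "simple_graph G \<longleftrightarrow> finite (verts G) \<and> edges G \<subseteq> complete_edges (verts G)"

definition neighborhood :: "'a graph \<Rightarrow> 'a \<Rightarrow> 'a set" where
  "neighborhood G u = {v \<in> verts G. {u, v} \<in> edges G}"

definition degree :: "'a graph \<Rightarrow> 'a \<Rightarrow> nat" where
  "degree G u = card (neighborhood G u)"

text \<open>Only meaningful for finite graphs with at least one vertex.\<close>

definition min_degree :: "'a graph \<Rightarrow> nat" where
  "min_degree G = Min (degree G ` verts G)"

definition local_complement :: "'a graph \<Rightarrow> 'a \<Rightarrow> 'a graph" where
  "local_complement G u =
    \<lparr>verts = verts G, edges = sym_diff (edges G) (complete_edges (neighborhood G u))\<rparr>"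

definition local_complement_step :: "'a graph \<Rightarrow> 'a graph \<Rightarrow> bool" where
  "local_complement_step G H \<longleftrightarrow> (\<exists>u \<in> verts G. H = local_complement G u)"

definition locally_equivalent :: "'a graph \<Rightarrow> 'a graph \<Rightarrow> bool" where
  "locally_equivalent = local_complement_step\<^sup>*\<^sup>*"

lemma verts_local_complement [simp]: "verts (local_complement G u) = verts G"
  by (simp add: local_complement_def)

lemma simple_graph_local_complement:
  assumes "simple_graph G"
  shows "simple_graph (local_complement G u)"
proof -
  have "complete_edges (neighborhood G u) \<subseteq> complete_edges (verts G)"
    unfolding complete_edges_def neighborhood_def by blast
  with assms show ?thesis
    unfolding simple_graph_def local_complement_def by auto
qed

lemma neighborhood_local_complement:
  assumes "simple_graph G"
  shows "neighborhood (local_complement G u) u = neighborhood G u"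
proof -
  have "{u} \<notin> edges G"
    using assms by (auto simp: simple_graph_def complete_edges_def)
  then have "u \<notin> neighborhood G u"
    by (simp add: neighborhood_def)
  then have "{u, v} \<notin> complete_edges (neighborhood G u)" for v
    by (simp add: complete_edges_def)
  then show ?thesis
    by (simp add: local_complement_def neighborhood_def[of _ u])
qed

lemma local_complement_involution:
  assumes "simple_graph G"
  shows "local_complement (local_complement G u) u = G"
proof -
  have "local_complement (local_complement G u) u =
      \<lparr>verts = verts G,
       edges = sym_diff (edges (local_complement G u)) (complete_edges (neighborhood G u))\<rparr>"
    unfolding local_complement_def[of "local_complement G u"]
    by (simp add: neighborhood_local_complement[OF assms])
  also have "sym_diff (edges (local_complement G u)) (complete_edges (neighborhood G u)) = edges G"
    by (simp add: local_complement_def) blast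
  finally show ?thesis by simp
qed

lemma locally_equivalent_simple_graph:
  assumes "locally_equivalent G H" "simple_graph G"
  shows "simple_graph H \<and> verts H = verts G"
  using assms(1) unfolding locally_equivalent_def
proof (induction rule: rtranclp_induct)
  case base
  show ?case using assms(2) by simp
next
  case (step H K)
  then obtain u where "K = local_complement H u"
    unfolding local_complement_step_def by blast
  with step.IH show ?case
    using simple_graph_local_complement[of H u] by simp
qed

lemma locally_equivalent_sym:
  assumes "locally_equivalent G H" "simple_graph G"
  shows "locally_equivalent H G"
  using assms(1) unfolding locally_equivalent_def
proof (induction rule: rtranclp_induct)
  case base
  show ?case by simp
next
  case (step H K)
  have "simple_graph H"
    using step.hyps(1) assms(2) locally_equivalent_simple_graph
    unfolding locally_equivalent_def by blast
  then have "local_complement_step K H"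
    using step.hyps(2) local_complement_involution unfolding local_complement_step_def
    by (metis verts_local_complement)
  then show ?case
    using step.IH by (rule converse_rtranclp_into_rtranclp)
qed

lemma finite_locally_equivalent:
  assumes "simple_graph G"
  shows "finite {H. locally_equivalent G H}"
proof (rule finite_subset)
  show "{H. locally_equivalent G H} \<subseteq>
      (\<lambda>E. \<lparr>verts = verts G, edges = E\<rparr>) ` Pow (Pow (verts G))"
  proof
    fix H assume "H \<in> {H. locally_equivalent G H}"
    then have "simple_graph H" "verts H = verts G"
      using locally_equivalent_simple_graph assms by auto
    then show "H \<in> (\<lambda>E. \<lparr>verts = verts G, edges = E\<rparr>) ` Pow (Pow (verts G))"
      by (intro image_eqI[where x = "edges H"])
         (auto simp: simple_graph_def complete_edges_def)
  qed
  show "finite ((\<lambda>E. \<lparr>verts = verts G, edges = E\<rparr>) ` Pow (Pow (verts G)))"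
    using assms by (simp add: simple_graph_def)
qed

definition local_min_degree :: "'a graph \<Rightarrow> nat" where
  "local_min_degree G = Min {min_degree H | H. locally_equivalent G H}"

lemma local_min_degree_attained:
  assumes "simple_graph G"
  shows "\<exists>H. locally_equivalent G H \<and> local_min_degree G = min_degree H"
proof -
  have "{min_degree H | H. locally_equivalent G H} = min_degree ` {H. locally_equivalent G H}"
    by blast
  then have "finite {min_degree H | H. locally_equivalent G H}"
    using finite_locally_equivalent[OF assms] by simp
  moreover have "{min_degree H | H. locally_equivalent G H} \<noteq> {}"
    by (auto simp: locally_equivalent_def)
  ultimately have "local_min_degree G \<in> {min_degree H | H. locally_equivalent G H}"
    unfolding local_min_degree_def by (rule Min_in)
  then show ?thesis by blast
qed

end

theory Submission
  imports Defs
begin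

text \<open>For nonempty \<open>D\<close>, the family of sets \<open>D \<union> Odd(D)\<close>, where \<open>Odd(D)\<close> is the set of vertices
  with an odd number of neighbors in \<open>D\<close>, is invariant under local complementation, and it contains
  the closed neighborhood of every vertex of every locally equivalent graph. So it suffices that all
  these sets have size more than \<open>0.189 n + 1\<close>. In a uniformly random graph \<open>Odd(D) - D\<close> is uniform on
  the subsets of \<open>V - D\<close>, so the expected number of sets \<open>D\<close> with \<open>D \<union> Odd(D)\<close> of size \<open>m\<close>
  is about \<open>(n choose m) 3^m / 2^n\<close>, which is exponentially small up to \<open>m = 7n/37 > 0.189 n\<close>.\<close>

section \<open>Odd neighborhoods under local complementation\<close>

definition odd_neighborhood :: "'a graph \<Rightarrow> 'a set \<Rightarrow> 'a set" where
  "odd_neighborhood G D = {v \<in> verts G. odd (card (neighborhood G v \<inter> D))}"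

lemma odd_card_sym_diff:
  assumes "finite A" "finite B"
  shows "odd (card (sym_diff A B)) \<longleftrightarrow> odd (card A) \<noteq> odd (card B)"
proof -
  have "card (sym_diff A B) = card (A - B) + card (B - A)"
    using assms by (intro card_Un_disjoint) auto
  moreover have "card A = card (A - B) + card (A \<inter> B)"
    using assms card_Int_Diff[of A B] by simp
  moreover have "card B = card (B - A) + card (A \<inter> B)"
    using assms card_Int_Diff[of B A] by (simp add: Int_commute)
  ultimately show ?thesis by auto
qed

lemma odd_card_sym_diff_Int:
  assumes "finite A" "finite B"
  shows "odd (card (sym_diff A B \<inter> D)) \<longleftrightarrow> odd (card (A \<inter> D)) \<noteq> odd (card (B \<inter> D))"
proof -
  have "sym_diff A B \<inter> D = sym_diff (A \<inter> D) (B \<inter> D)" by blast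
  then show ?thesis using assms odd_card_sym_diff[of "A \<inter> D" "B \<inter> D"] by simp
qed

lemma finite_neighborhood: "simple_graph G \<Longrightarrow> finite (neighborhood G u)"
  by (simp add: simple_graph_def neighborhood_def)

lemma neighborhood_irrefl: "simple_graph G \<Longrightarrow> u \<notin> neighborhood G u"
  by (auto simp: simple_graph_def complete_edges_def neighborhood_def)

lemma neighborhood_sym:
  "u \<in> verts G \<Longrightarrow> v \<in> neighborhood G u \<Longrightarrow> u \<in> neighborhood G v"
  by (auto simp: neighborhood_def insert_commute)

lemma neighborhood_local_complement_other:
  assumes "simple_graph G"
  shows "neighborhood (local_complement G u) v =
    (if v \<in> neighborhood G u then sym_diff (neighborhood G v) (neighborhood G u - {v})
     else neighborhood G v)"
proof -
  have "{v, w} \<in> complete_edges N \<longleftrightarrow> v \<in> N \<and> w \<in> N \<and> v \<noteq> w" for w and N :: "'a set"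
    by (auto simp: complete_edges_def card_insert_if)
  then show ?thesis
    by (auto simp: local_complement_def neighborhood_def)
qed

text \<open>Parity is additive under symmetric difference. The neighborhood of a neighbor
  \<open>v\<close> of \<open>u\<close> is toggled by that of \<open>u\<close> without
  \<open>v\<close>, so the parity of the latter within \<open>D\<close> needs a correction when
  \<open>v \<in> D\<close>.\<close>

lemma odd_neighborhood_local_complement:
  assumes "simple_graph G"
  shows "v \<in> odd_neighborhood (local_complement G u) D \<longleftrightarrow>
    (v \<in> odd_neighborhood G D) \<noteq>
    (v \<in> neighborhood G u \<and> odd (card (neighborhood G u \<inter> D)) \<noteq> (v \<in> D))"
proof -
  have fin: "finite (neighborhood G w)" for w
    by (rule finite_neighborhood[OF assms])
  have *: "odd (card ((neighborhood G u - {v}) \<inter> D)) \<longleftrightarrow>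
      odd (card (neighborhood G u \<inter> D)) \<noteq> (v \<in> D)" if "v \<in> neighborhood G u"
  proof -
    have "neighborhood G u - {v} = sym_diff (neighborhood G u) {v}" using that by blast
    then have "odd (card ((neighborhood G u - {v}) \<inter> D)) \<longleftrightarrow>
        odd (card (neighborhood G u \<inter> D)) \<noteq> odd (card ({v} \<inter> D))"
      using odd_card_sym_diff_Int[OF fin[of u], of "{v}" D] by simp
    then show ?thesis by (cases "v \<in> D") auto
  qed
  have "v \<in> neighborhood G u \<Longrightarrow> v \<in> verts G" by (simp add: neighborhood_def)
  then show ?thesis
    unfolding odd_neighborhood_def neighborhood_local_complement_other[OF assms]
    using odd_card_sym_diff_Int[OF fin[of v], of "neighborhood G u - {v}" D] fin[of u] *
    by auto
qed

text \<open>If \<open>u\<close> has evenly many neighbors in \<open>D\<close>, complementation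
  alters the odd neighborhood only inside \<open>D\<close>, so \<open>D\<close> itself serves. If
  oddly many, it toggles the neighbors of \<open>u\<close> outside \<open>D\<close>; in
  \<open>G\<close> the same effect outside \<open>D\<close> comes from toggling \<open>u\<close> in
  \<open>D\<close>.\<close>

lemma local_complement_closed_odd_neighborhood:
  assumes "simple_graph G" "u \<in> verts G" "D \<subseteq> verts G" "D \<noteq> {}"
  obtains D' where "D' \<subseteq> verts G" "D' \<noteq> {}"
    "D' \<union> odd_neighborhood G D' = D \<union> odd_neighborhood (local_complement G u) D"
proof (cases "odd (card (neighborhood G u \<inter> D))")
  case False
  then have "D \<union> odd_neighborhood G D = D \<union> odd_neighborhood (local_complement G u) D"
    by (auto simp: odd_neighborhood_local_complement[OF assms(1)])
  with assms(3,4) show ?thesis by (intro that)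
next
  case True
  define D' where "D' = sym_diff D {u}"
  note fin = finite_neighborhood[OF assms(1)]
  have irr: "u \<notin> neighborhood G u" by (rule neighborhood_irrefl[OF assms(1)])
  \<comment> \<open>This keeps \<open>D'\<close> nonempty: for \<open>D = {u}\<close> the parity
    would be even.\<close>
  have "D \<noteq> {u}"
    using True irr by auto
  have odd': "v \<in> odd_neighborhood G D' \<longleftrightarrow> (v \<in> odd_neighborhood G D) \<noteq> (v \<in> neighborhood G u)" for v
  proof (cases "v \<in> verts G")
    case True
    have "finite D" using assms by (metis finite_subset simple_graph_def)
    then have "odd (card (neighborhood G v \<inter> D')) \<longleftrightarrow>
        odd (card (neighborhood G v \<inter> D)) \<noteq> odd (card (neighborhood G v \<inter> {u}))"
      using odd_card_sym_diff_Int[of D "{u}" "neighborhood G v"]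
      unfolding D'_def by (simp add: Int_commute)
    moreover have "odd (card (neighborhood G v \<inter> {u})) \<longleftrightarrow> v \<in> neighborhood G u"
      using neighborhood_sym[of u G v] neighborhood_sym[of v G u] assms(2) True
      by (cases "u \<in> neighborhood G v") auto
    ultimately show ?thesis using True by (auto simp: odd_neighborhood_def)
  qed (simp add: odd_neighborhood_def neighborhood_def)
  have mem': "v \<in> D' \<longleftrightarrow> (v \<in> D) \<noteq> (v = u)" for v
    by (auto simp: D'_def)
  \<comment> \<open>As \<open>u\<close> is not its own neighbor, neither operation changes whether
    it is odd, so it lies in both unions even if it leaves \<open>D\<close>.\<close>
  have "u \<in> odd_neighborhood G D"
    using True assms(2) by (simp add: odd_neighborhood_def)
  then have "v \<in> D' \<union> odd_neighborhood G D' \<longleftrightarrow>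
      v \<in> D \<union> odd_neighborhood (local_complement G u) D" for v
    using True irr
    by (cases "v = u")
      (auto simp: mem' odd' odd_neighborhood_local_complement[OF assms(1)])
  then have "D' \<union> odd_neighborhood G D' = D \<union> odd_neighborhood (local_complement G u) D"
    by blast
  moreover have "D' \<subseteq> verts G" "D' \<noteq> {}"
    using assms(2-4) \<open>D \<noteq> {u}\<close> by (auto simp: D'_def)
  ultimately show ?thesis by (intro that)
qed

lemma locally_equivalent_closed_odd_neighborhood:
  assumes "locally_equivalent G H" "simple_graph G" "D \<subseteq> verts G" "D \<noteq> {}"
  shows "\<exists>D' \<subseteq> verts G. D' \<noteq> {} \<and>
    D' \<union> odd_neighborhood G D' = D \<union> odd_neighborhood H D"
  using assms(1,3,4) unfolding locally_equivalent_def
proof (induction arbitrary: D rule: rtranclp_induct)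
  case base
  then show ?case by blast
next
  case (step H K)
  have H: "simple_graph H" "verts H = verts G"
    using step.hyps(1) assms(2) locally_equivalent_simple_graph[of G H]
    by (auto simp: locally_equivalent_def)
  obtain u where u: "u \<in> verts H" "K = local_complement H u"
    using step.hyps(2) by (auto simp: local_complement_step_def)
  obtain D1 where "D1 \<subseteq> verts H" "D1 \<noteq> {}"
    "D1 \<union> odd_neighborhood H D1 = D \<union> odd_neighborhood K D"
    using local_complement_closed_odd_neighborhood[of H u D] H u step.prems by metis
  then show ?case using step.IH[of D1] H by simp
qed

text \<open>Take an equivalent graph attaining the minimum and a vertex \<open>v\<close> of least
  degree there. For the singleton \<open>{v}\<close> the closed set is the closed neighborhood of
  \<open>v\<close>, whence the \<open>+ 1\<close>; invariance transports it to
  \<open>G\<close>.\<close>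

lemma local_min_degree_witness:
  assumes "simple_graph G" "verts G \<noteq> {}"
  shows "\<exists>D \<subseteq> verts G. D \<noteq> {} \<and>
    card (D \<union> odd_neighborhood G D) = local_min_degree G + 1"
proof -
  obtain H where H: "locally_equivalent G H" "local_min_degree G = min_degree H"
    using local_min_degree_attained[OF assms(1)] by blast
  have sH: "simple_graph H" "verts H = verts G"
    using locally_equivalent_simple_graph[OF H(1) assms(1)] by auto
  have "Min (degree H ` verts H) \<in> degree H ` verts H"
    using assms sH by (intro Min_in) (auto simp: simple_graph_def)
  then obtain v where v: "v \<in> verts G" "local_min_degree G = card (neighborhood H v)"
    using H(2) sH(2) by (auto simp: min_degree_def degree_def)
  have "odd (card (neighborhood H w \<inter> {v})) \<longleftrightarrow> v \<in> neighborhood H w" for w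
    by (cases "v \<in> neighborhood H w") auto
  then have "odd_neighborhood H {v} = neighborhood H v"
    using v(1) sH(2) neighborhood_sym[of _ H]
    by (auto simp: odd_neighborhood_def) (auto simp: neighborhood_def)
  then have "card ({v} \<union> odd_neighborhood H {v}) = local_min_degree G + 1"
    using v(2) finite_neighborhood[OF sH(1)] neighborhood_irrefl[OF sH(1)] by simp
  moreover obtain D where "D \<subseteq> verts G" "D \<noteq> {}"
    "D \<union> odd_neighborhood G D = {v} \<union> odd_neighborhood H {v}"
    using locally_equivalent_closed_odd_neighborhood[OF H(1) assms(1), of "{v}"] v(1) by blast
  ultimately show ?thesis by metis
qed

section \<open>Counting graphs with a small closed odd neighborhood\<close>

text \<open>When the product of \<open>y + 1\<close> over \<open>A\<close> is expanded,
  \<open>B\<close> records the factors contributing \<open>y\<close>.\<close>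

lemma sum_power_card_Pow:
  fixes y :: "'b :: comm_semiring_1"
  assumes "finite A"
  shows "(\<Sum>B\<in>Pow A. y ^ card B) = (1 + y) ^ card A"
  using prod_add[OF assms, of "\<lambda>_. y" "\<lambda>_. 1"] by (simp add: add.commute)

text \<open>Toggling edges between a fixed vertex of \<open>D\<close> and a set \<open>T\<close> outside \<open>D\<close> changes the odd
  neighborhood outside \<open>D\<close> by exactly \<open>T\<close>, so all its values occur equally often.\<close>

lemma card_graphs_closed_odd_neighborhood:
  assumes "finite V" "D \<subseteq> V" "D \<noteq> {}"
  shows "card {E \<in> Pow (complete_edges V).
      D \<union> odd_neighborhood \<lparr>verts = V, edges = E\<rparr> D = W} * 2 ^ card (V - D)
    \<le> card (Pow (complete_edges V))"
proof -
  obtain a where a: "a \<in> D" using assms(3) by blast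
  let ?G = "\<lambda>E. \<lparr>verts = V, edges = E\<rparr>"
  define C where "C = {E \<in> Pow (complete_edges V). D \<union> odd_neighborhood (?G E) D = W}"
  define f where "f = (\<lambda>(E, T). sym_diff E ((\<lambda>v. {a, v}) ` T))"
  have fin: "finite (complete_edges V)"
    by (rule finite_subset[of _ "Pow V"]) (use assms(1) in \<open>auto simp: complete_edges_def\<close>)
  \<comment> \<open>Since \<open>W - D\<close> is fixed, the image \<open>f (E, T)\<close>
    determines \<open>T\<close> and then \<open>E\<close>. This makes \<open>f\<close> injective. A
    vertex outside \<open>D\<close> can gain or lose only the neighbor \<open>a\<close> within
    \<open>D\<close>.\<close>
  have odd_f: "odd_neighborhood (?G (f (E, T))) D - D = sym_diff (W - D) T"
    if "E \<in> C" "T \<subseteq> V - D" for E T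
  proof -
    have "neighborhood (?G (f (E, T))) v \<inter> D =
        sym_diff (neighborhood (?G E) v) (if v \<in> T then {a} else {}) \<inter> D"
      if "v \<in> V - D" for v
      using that \<open>T \<subseteq> V - D\<close> a assms(2)
      by (auto simp: neighborhood_def f_def doubleton_eq_iff image_iff)
    moreover have "finite (neighborhood (?G E) v)" for v
      using assms(1) by (simp add: neighborhood_def)
    ultimately have "v \<in> odd_neighborhood (?G (f (E, T))) D \<longleftrightarrow>
        (v \<in> odd_neighborhood (?G E) D) \<noteq> (v \<in> T)" if "v \<in> V - D" for v
      using that a odd_card_sym_diff_Int[of "neighborhood (?G E) v" "if v \<in> T then {a} else {}" D]
      by (auto simp: odd_neighborhood_def)
    moreover have "W = D \<union> odd_neighborhood (?G E) D"
      using \<open>E \<in> C\<close> by (simp add: C_def)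
    moreover have "odd_neighborhood (?G F) D \<subseteq> V" for F
      by (auto simp: odd_neighborhood_def)
    ultimately show ?thesis using that by blast
  qed
  have "inj_on f (C \<times> Pow (V - D))"
  proof (rule inj_onI, clarify)
    fix E T E' T'
    assume *: "E \<in> C" "T \<subseteq> V - D" "E' \<in> C" "T' \<subseteq> V - D" and eq: "f (E, T) = f (E', T')"
    have "sym_diff (W - D) T = sym_diff (W - D) T'"
      using odd_f[OF *(1,2)] odd_f[OF *(3,4)] eq by simp
    then have "T = T'" by blast
    moreover from this eq have "E = E'" unfolding f_def by blast
    ultimately show "E = E' \<and> T = T'" by simp
  qed
  moreover have "f ` (C \<times> Pow (V - D)) \<subseteq> Pow (complete_edges V)"
  proof -
    have "(\<lambda>v. {a, v}) ` T \<subseteq> complete_edges V" if "T \<subseteq> V - D" for T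
      using that a assms(2) by (auto simp: complete_edges_def card_insert_if)
    then have "f (E, T) \<subseteq> complete_edges V" if "E \<in> C" "T \<subseteq> V - D" for E T
      using that unfolding f_def C_def prod.case by blast
    then show ?thesis by auto
  qed
  ultimately have "card (C \<times> Pow (V - D)) \<le> card (Pow (complete_edges V))"
    using fin by (intro card_inj_on_le) auto
  then show ?thesis
    using assms(1) by (simp add: C_def card_cartesian_product card_Pow)
qed

text \<open>The union bound over \<open>D \<subseteq> W\<close> contributes \<open>2 ^ card D / 2 ^ card V\<close> for each pair; the sum
  over \<open>card W \<le> t\<close> is estimated by Chernoff's device of inserting the weight
  \<open>x ^ card W / x powr t \<ge> 1\<close>.\<close>

lemma exists_graph_closed_odd_neighborhood_large:
  fixes x t :: real
  assumes "finite V" "0 < x" "x \<le> 1" and small: "(1 + 3 * x) ^ card V < 2 ^ card V * x powr t"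
  obtains G where "simple_graph G" "verts G = V"
    "\<And>D. D \<subseteq> V \<Longrightarrow> D \<noteq> {} \<Longrightarrow> t < real (card (D \<union> odd_neighborhood G D))"
proof -
  let ?G = "\<lambda>E. \<lparr>verts = V, edges = E\<rparr>"
  let ?\<E> = "Pow (complete_edges V)"
  define N where "N = real (card ?\<E>)"
  \<comment> \<open>\<open>P\<close> lists the bad pairs, and \<open>C\<close> the edge sets
    realizing a given pair. An edge set outside every \<open>C p\<close> gives the required
    graph.\<close>
  define P where "P = {(W, D). W \<subseteq> V \<and> real (card W) \<le> t \<and> D \<subseteq> W \<and> D \<noteq> {}}"
  define C where "C = (\<lambda>(W, D). {E \<in> ?\<E>. D \<union> odd_neighborhood (?G E) D = W})"
  have fin: "finite ?\<E>"
    using assms(1) by (intro finite_Pow_iff[THEN iffD2] finite_subset[of _ "Pow V"])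
      (auto simp: complete_edges_def)
  have "N > 0" using fin by (auto simp: N_def card_gt_0_iff)
  have P_sub: "P \<subseteq> Sigma (Pow V) Pow" by (auto simp: P_def)
  have fin_Sigma: "finite (Sigma (Pow V) Pow)"
    using assms(1) by (intro finite_SigmaI) (auto intro: finite_subset)
  have fin_P: "finite P" using P_sub fin_Sigma by (rule finite_subset)
  have card_C: "real (card (C (W, D))) \<le>
      N / 2 ^ card V * (x ^ card W * 2 ^ card D) / x powr t" if "(W, D) \<in> P" for W D
  proof -
    have D: "D \<subseteq> V" "D \<noteq> {}" "real (card W) \<le> t" using that by (auto simp: P_def)
    have "real (card (C (W, D))) * 2 ^ card (V - D) \<le> N"
      using of_nat_mono[OF card_graphs_closed_odd_neighborhood[OF assms(1) D(1,2), of W],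
          where 'a = real]
      by (simp add: N_def C_def del: Pow_iff)
    then have "real (card (C (W, D))) * 2 ^ card (V - D) * 2 ^ card D \<le> N * 2 ^ card D"
      by (rule mult_right_mono) simp
    moreover have "card V = card (V - D) + card D"
      using D(1) assms(1) by (simp add: card_Diff_subset finite_subset card_mono)
    ultimately have "real (card (C (W, D))) * 2 ^ card V \<le> N * 2 ^ card D"
      by (simp add: power_add mult.assoc)
    then have "real (card (C (W, D))) \<le> N / 2 ^ card V * 2 ^ card D"
      by (simp add: field_simps)
    also have "\<dots> \<le> N / 2 ^ card V * 2 ^ card D * (x ^ card W / x powr t)"
    proof -
      have "x powr t \<le> x powr real (card W)"
        using D(3) assms(2,3) by (intro powr_mono') auto
      then have "1 \<le> x ^ card W / x powr t"
        using assms(2) by (simp add: powr_realpow)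
      then show ?thesis
        using \<open>N > 0\<close> mult_left_mono[of 1 "x ^ card W / x powr t" "N / 2 ^ card V * 2 ^ card D"]
        by simp
    qed
    finally show ?thesis by (simp add: field_simps)
  qed
  have "real (card (\<Union>p\<in>P. C p)) \<le> (\<Sum>p\<in>P. real (card (C p)))"
    using of_nat_mono[OF card_UN_le[OF fin_P, of C], where 'a = real] by simp
  also have "\<dots> \<le> (\<Sum>(W, D)\<in>P. N / 2 ^ card V * (x ^ card W * 2 ^ card D) / x powr t)"
    by (rule sum_mono) (use card_C in auto)
  \<comment> \<open>Dropping the restrictions in \<open>P\<close> only adds nonnegative terms. The
    full sum is then evaluated by \<open>sum_power_card_Pow\<close> twice, with \<open>y = 2\<close>
    inside and \<open>y = 3 * x\<close> outside.\<close>
  also have "\<dots> \<le> (\<Sum>(W, D)\<in>Sigma (Pow V) Pow.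
      N / 2 ^ card V * (x ^ card W * 2 ^ card D) / x powr t)"
    using assms(2) \<open>N > 0\<close> by (intro sum_mono2 fin_Sigma P_sub) auto
  also have "\<dots> = N / 2 ^ card V / x powr t *
      (\<Sum>(W, D)\<in>Sigma (Pow V) Pow. x ^ card W * 2 ^ card D)"
    by (simp add: sum_distrib_left case_prod_unfold)
  also have "(\<Sum>(W, D)\<in>Sigma (Pow V) Pow. x ^ card W * 2 ^ card D) =
      (\<Sum>W\<in>Pow V. \<Sum>D\<in>Pow W. x ^ card W * 2 ^ card D)"
    using assms(1) by (intro sum.Sigma[symmetric]) (auto intro: finite_subset)
  also have "\<dots> = (\<Sum>W\<in>Pow V. (3 * x) ^ card W)"
  proof (rule sum.cong)
    fix W assume "W \<in> Pow V"
    then have "finite W" using assms(1) by (auto intro: finite_subset)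
    then show "(\<Sum>D\<in>Pow W. x ^ card W * 2 ^ card D) = (3 * x) ^ card W"
      by (simp add: sum_power_card_Pow power_mult_distrib flip: sum_distrib_left)
  qed simp
  also have "\<dots> = (1 + 3 * x) ^ card V"
    by (rule sum_power_card_Pow[OF assms(1)])
  also have "N / 2 ^ card V / x powr t * (1 + 3 * x) ^ card V < N"
    using small \<open>N > 0\<close> assms(2) by (simp add: field_simps)
  finally have "card (\<Union>p\<in>P. C p) < card ?\<E>" by (simp add: N_def)
  moreover have "finite (\<Union>p\<in>P. C p)"
    using fin by (rule finite_subset[rotated]) (auto simp: C_def)
  ultimately obtain E where E: "E \<in> ?\<E>" "E \<notin> (\<Union>p\<in>P. C p)"
    by (metis card_mono not_less subsetI)
  show ?thesis
  proof (rule that[of "?G E"])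
    show "simple_graph (?G E)" using E(1) assms(1) by (simp add: simple_graph_def)
    show "t < real (card (D \<union> odd_neighborhood (?G E) D))" if "D \<subseteq> V" "D \<noteq> {}" for D
    proof (rule ccontr)
      assume "\<not> ?thesis"
      then have "(D \<union> odd_neighborhood (?G E) D, D) \<in> P"
        using that by (auto simp: P_def odd_neighborhood_def)
      then show False using E by (force simp: C_def)
    qed
  qed simp
qed

section \<open>Numerical estimate and conclusion\<close>

text \<open>For \<open>t = c n\<close> the optimal weight satisfies \<open>3x / (1 + 3x) = c\<close>; at \<open>c = 7/37\<close> this gives
  \<open>x = 7/90\<close> and \<open>1 + 3x = 37/30\<close>.\<close>

lemma powr_7_90_bound: "37/60 < (7/90 :: real) powr (7/37)"
\<comment> \<open>The 37th power clears the fractional exponent and leaves a comparison of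
  rationals.\<close>
proof (rule power_less_imp_less_base[where n = 37])
  have "(37/60 :: real) ^ 37 < (7/90) ^ 7" by (simp add: power_divide divide_simps)
  also have "\<dots> = ((7/90) powr (7/37)) ^ 37"
    by (simp add: powr_power)
  finally show "(37/60 :: real) ^ 37 < ((7/90) powr (7/37)) ^ 37" .
qed simp

theorem theorem3:
  shows "\<exists>n\<^sub>0 :: nat. \<forall>n > n\<^sub>0. \<exists>G :: nat graph.
    simple_graph G \<and> card (verts G) = n \<and> real (local_min_degree G) > 0.189 * real n"
proof -
  \<comment> \<open>With \<open>x = 7/90\<close> and the \<open>t\<close> chosen below, dividing the
    hypothesis \<open>small\<close> by \<open>2 ^ n\<close> and by \<open>x powr (7/37 * n)\<close>
    turns it into \<open>r ^ n < 7/90\<close>.\<close>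
  define r :: real where "r = (37/60) / (7/90) powr (7/37)"
  have "0 < r" by (simp add: r_def)
  moreover have "r < 1" using powr_7_90_bound by (simp add: r_def divide_less_eq)
  ultimately have "(\<lambda>n. r ^ n) \<longlonglongrightarrow> 0" by (intro LIMSEQ_power_zero) simp
  then have "\<forall>\<^sub>F n in sequentially. r ^ n < 7/90"
    by (rule order_tendstoD(2)) simp
  then obtain n0 where n0: "\<And>n. n \<ge> n0 \<Longrightarrow> r ^ n < 7/90"
    by (auto simp: eventually_sequentially)
  show ?thesis
  proof (intro exI[of _ n0] allI impI)
    fix n assume "n > n0"
    \<comment> \<open>The \<open>+ 1\<close> pays for the vertex itself in its closed neighborhood;
      it costs only the constant factor \<open>7/90\<close>, absorbed for large
      \<open>n\<close>.\<close>
    define t where "t = 7/37 * real n + 1"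
    have "(37/30) ^ n = r ^ n * (2 ^ n * ((7/90) powr (7/37)) ^ n)"
    proof -
      have "37/30 = r * (2 * (7/90) powr (7/37))" by (simp add: r_def)
      then show ?thesis by (simp only: power_mult_distrib)
    qed
    also have "\<dots> < 7/90 * (2 ^ n * ((7/90) powr (7/37)) ^ n)"
      using n0[of n] \<open>n > n0\<close> by (intro mult_strict_right_mono) auto
    also have "\<dots> = 2 ^ n * (7/90) powr t"
      by (simp add: t_def powr_add powr_power mult.commute)
    finally have "(1 + 3 * (7/90)) ^ card {..<n} < 2 ^ card {..<n} * (7/90::real) powr t"
      by simp
    then obtain G :: "nat graph" where G: "simple_graph G" "verts G = {..<n}"
      "\<And>D. D \<subseteq> {..<n} \<Longrightarrow> D \<noteq> {} \<Longrightarrow> t < real (card (D \<union> odd_neighborhood G D))"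
      by (rule exists_graph_closed_odd_neighborhood_large[rotated 3]) auto
    have "verts G \<noteq> {}" using \<open>n > n0\<close> G(2) by (auto simp: lessThan_empty_iff)
    then obtain D where D: "D \<subseteq> verts G" "D \<noteq> {}"
      "card (D \<union> odd_neighborhood G D) = local_min_degree G + 1"
      using local_min_degree_witness[OF G(1)] by blast
    then have "t < real (local_min_degree G) + 1" using G(2) G(3)[of D] by simp
    then have "real (local_min_degree G) > 0.189 * real n"
      by (simp add: t_def)
    then show "\<exists>G :: nat graph. simple_graph G \<and> card (verts G) = n \<and>
        real (local_min_degree G) > 0.189 * real n"
      using G(1,2) by auto
  qed
qed

end
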